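(* There is a Kelley algebra supporting only separable measures but no uniformly regular one. That is, there is a Boolean algebra $\mathfrak{A}$ which supports a measure, such that every measure supported by $\mathfrak{A}$ is separable and no measure supported by $\mathfrak{A}$ is uniformly regular.
   Context: A measure on a Boolean algebra is a finitely additive non-negative function with value $1$ at the unit. $\mathfrak{A}$ supports $\mu$ if $\mu$ is defined on all of $\mathfrak{A}$ and strictly positive; a Kelley algebra is a Boolean algebra supporting a measure. $\mu$ on $\mathfrak{A}$ is separable if there is a countable $\mathcal{D}\subseteq\mathfrak{A}$ such that for every $a\in\mathfrak{A}$ and $\varepsilon>0$ there is $d\in\mathcal{D}$ with $\mu(a\bigtriangleup d)<\varepsilon$. $\mu$ is uniformly regular if there is a countable $\mathcal{D}\subseteq\mathfrak{A}$ such that for every $a\in\mathfrak{A}$ and $\varepsilon>0$ there is $d\in\mathcal{D}$ with $d\le a$ and $\mu(a\setminus d)<\varepsilon$. *)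

theory Defs
  imports Complex_Main "HOL-Library.Countable_Set"
begin

text \<open>Boolean algebras with an explicit carrier, so that a theorem can assert the existence of one.
  The axioms are those of the library locale \<open>abstract_boolean_algebra\<close>, relativised to the carrier.\<close>

record 'a bool_alg =
  elems :: "'a set"
  bmeet :: "'a \<Rightarrow> 'a \<Rightarrow> 'a"
  bjoin :: "'a \<Rightarrow> 'a \<Rightarrow> 'a"
  bcompl :: "'a \<Rightarrow> 'a"
  bzero :: 'a
  bunit :: 'a

locale bool_algebra =
  fixes \<AA> :: "'a bool_alg"
  assumes zero_closed: "bzero \<AA> \<in> elems \<AA>"
    and unit_closed: "bunit \<AA> \<in> elems \<AA>"
    and compl_closed: "a \<in> elems \<AA> \<Longrightarrow> bcompl \<AA> a \<in> elems \<AA>"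
    and meet_closed: "\<lbrakk>a \<in> elems \<AA>; b \<in> elems \<AA>\<rbrakk> \<Longrightarrow> bmeet \<AA> a b \<in> elems \<AA>"
    and join_closed: "\<lbrakk>a \<in> elems \<AA>; b \<in> elems \<AA>\<rbrakk> \<Longrightarrow> bjoin \<AA> a b \<in> elems \<AA>"
    and meet_assoc: "\<lbrakk>a \<in> elems \<AA>; b \<in> elems \<AA>; c \<in> elems \<AA>\<rbrakk> \<Longrightarrow>
          bmeet \<AA> (bmeet \<AA> a b) c = bmeet \<AA> a (bmeet \<AA> b c)"
    and join_assoc: "\<lbrakk>a \<in> elems \<AA>; b \<in> elems \<AA>; c \<in> elems \<AA>\<rbrakk> \<Longrightarrow>
          bjoin \<AA> (bjoin \<AA> a b) c = bjoin \<AA> a (bjoin \<AA> b c)"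
    and meet_commute: "\<lbrakk>a \<in> elems \<AA>; b \<in> elems \<AA>\<rbrakk> \<Longrightarrow> bmeet \<AA> a b = bmeet \<AA> b a"
    and join_commute: "\<lbrakk>a \<in> elems \<AA>; b \<in> elems \<AA>\<rbrakk> \<Longrightarrow> bjoin \<AA> a b = bjoin \<AA> b a"
    and meet_join_distrib: "\<lbrakk>a \<in> elems \<AA>; b \<in> elems \<AA>; c \<in> elems \<AA>\<rbrakk> \<Longrightarrow>
          bmeet \<AA> a (bjoin \<AA> b c) = bjoin \<AA> (bmeet \<AA> a b) (bmeet \<AA> a c)"
    and join_meet_distrib: "\<lbrakk>a \<in> elems \<AA>; b \<in> elems \<AA>; c \<in> elems \<AA>\<rbrakk> \<Longrightarrow>
          bjoin \<AA> a (bmeet \<AA> b c) = bmeet \<AA> (bjoin \<AA> a b) (bjoin \<AA> a c)"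
    and meet_unit: "a \<in> elems \<AA> \<Longrightarrow> bmeet \<AA> a (bunit \<AA>) = a"
    and join_zero: "a \<in> elems \<AA> \<Longrightarrow> bjoin \<AA> a (bzero \<AA>) = a"
    and meet_compl: "a \<in> elems \<AA> \<Longrightarrow> bmeet \<AA> a (bcompl \<AA> a) = bzero \<AA>"
    and join_compl: "a \<in> elems \<AA> \<Longrightarrow> bjoin \<AA> a (bcompl \<AA> a) = bunit \<AA>"

definition ble :: "'a bool_alg \<Rightarrow> 'a \<Rightarrow> 'a \<Rightarrow> bool" where
  "ble \<AA> a b \<longleftrightarrow> bmeet \<AA> a b = a"

definition bdiff :: "'a bool_alg \<Rightarrow> 'a \<Rightarrow> 'a \<Rightarrow> 'a" where
  "bdiff \<AA> a b = bmeet \<AA> a (bcompl \<AA> b)"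

definition bsymdiff :: "'a bool_alg \<Rightarrow> 'a \<Rightarrow> 'a \<Rightarrow> 'a" where
  "bsymdiff \<AA> a b = bjoin \<AA> (bdiff \<AA> a b) (bdiff \<AA> b a)"

text \<open>Only the values of \<open>\<mu>\<close> on \<open>elems \<AA>\<close> matter; values elsewhere are unconstrained.\<close>

definition ba_measure :: "'a bool_alg \<Rightarrow> ('a \<Rightarrow> real) \<Rightarrow> bool" where
  "ba_measure \<AA> \<mu> \<longleftrightarrow>
     (\<forall>a\<in>elems \<AA>. 0 \<le> \<mu> a) \<and>
     \<mu> (bunit \<AA>) = 1 \<and>
     (\<forall>a\<in>elems \<AA>. \<forall>b\<in>elems \<AA>. bmeet \<AA> a b = bzero \<AA> \<longrightarrow> \<mu> (bjoin \<AA> a b) = \<mu> a + \<mu> b)"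

definition supports :: "'a bool_alg \<Rightarrow> ('a \<Rightarrow> real) \<Rightarrow> bool" where
  "supports \<AA> \<mu> \<longleftrightarrow> ba_measure \<AA> \<mu> \<and> (\<forall>a\<in>elems \<AA>. a \<noteq> bzero \<AA> \<longrightarrow> 0 < \<mu> a)"

definition kelley_algebra :: "'a bool_alg \<Rightarrow> bool" where
  "kelley_algebra \<AA> \<longleftrightarrow> bool_algebra \<AA> \<and> (\<exists>\<mu>. supports \<AA> \<mu>)"

definition separable_measure :: "'a bool_alg \<Rightarrow> ('a \<Rightarrow> real) \<Rightarrow> bool" where
  "separable_measure \<AA> \<mu> \<longleftrightarrow>
     (\<exists>D. countable D \<and> D \<subseteq> elems \<AA> \<and>
        (\<forall>a\<in>elems \<AA>. \<forall>\<epsilon>>0. \<exists>d\<in>D. \<mu> (bsymdiff \<AA> a d) < \<epsilon>))"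

definition uniformly_regular :: "'a bool_alg \<Rightarrow> ('a \<Rightarrow> real) \<Rightarrow> bool" where
  "uniformly_regular \<AA> \<mu> \<longleftrightarrow>
     (\<exists>D. countable D \<and> D \<subseteq> elems \<AA> \<and>
        (\<forall>a\<in>elems \<AA>. \<forall>\<epsilon>>0. \<exists>d\<in>D. ble \<AA> d a \<and> \<mu> (bdiff \<AA> a d) < \<epsilon>))"

text \<open>HOL cannot quantify existentially over types, so an existence statement about Boolean algebras
  must name a type that contains the elements. For Boolean algebras supporting a separable measure
  \<open>\<mu>\<close>, every type with at least continuum many elements is fully general up to isomorphism:
  \<open>\<mu> (bsymdiff \<AA> a b)\<close> is then a separable metric on \<open>elems \<AA>\<close>, so \<open>elems \<AA>\<close> has at most
  continuum many elements. The type \<^typ>\<open>real set\<close> is one such, and it also accommodates fields of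
  subsets of the reals directly.\<close>

end

theory Submission
  imports Defs "HOL-Probability.Probability_Measure" "HOL-Library.Countable_Set_Type"
begin

text \<open>Inside the measure algebra of \<open>[0, 1]\<close>, start from a countable dense algebra \<open>C\<close> and add non-null
  sets \<open>a i\<close>, \<open>i < \<omega>\<^sub>1\<close>, such that every \<open>s\<close> in the countable algebra generated by \<open>C\<close> and the
  earlier \<open>a j\<close> has the same trace on \<open>a i\<close> as some \<open>c \<in> C\<close>, and such that \<open>a i\<close> contains no non-null
  such \<open>s\<close>. It suffices to let \<open>a i\<close> be the complement of the union, over all \<open>s\<close>, of a tiny set
  \<open>s \<triangle> c\<close> and a tiny non-null subset of \<open>s\<close>. By the second property no countable set is dense in
  the order sense, whereas a strictly positive uniformly regular measure provides one. By the first
  property, for any finitely additive measure only countably many \<open>a i\<close> stay at distance at least \<open>\<epsilon>\<close>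
  from the algebra preceding them, so the countable algebra generated by \<open>C\<close> and these exceptions,
  for all \<open>\<epsilon> = 1/n\<close>, is dense in the measure metric.\<close>

section \<open>Algebras of sets generated by a family\<close>

inductive_set set_algebra :: "'a set set \<Rightarrow> 'a set set" for G where
  UNIV: "UNIV \<in> set_algebra G"
| base: "g \<in> G \<Longrightarrow> g \<in> set_algebra G"
| compl: "s \<in> set_algebra G \<Longrightarrow> - s \<in> set_algebra G"
| inter: "\<lbrakk>s \<in> set_algebra G; t \<in> set_algebra G\<rbrakk> \<Longrightarrow> s \<inter> t \<in> set_algebra G"

lemma set_algebra_empty: "{} \<in> set_algebra G"
  using set_algebra.compl[OF set_algebra.UNIV] by simp

lemma set_algebra_union:
  assumes "s \<in> set_algebra G" "t \<in> set_algebra G"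
  shows "s \<union> t \<in> set_algebra G"
proof -
  have "- (- s \<inter> - t) \<in> set_algebra G"
    using assms by (intro set_algebra.compl set_algebra.inter)
  then show ?thesis by simp
qed

lemma set_algebra_diff:
  "\<lbrakk>s \<in> set_algebra G; t \<in> set_algebra G\<rbrakk> \<Longrightarrow> s - t \<in> set_algebra G"
  by (simp add: Diff_eq set_algebra.compl set_algebra.inter)

lemma set_algebra_UN:
  "\<lbrakk>finite I; \<And>i. i \<in> I \<Longrightarrow> f i \<in> set_algebra G\<rbrakk> \<Longrightarrow> (\<Union>i\<in>I. f i) \<in> set_algebra G"
  by (induction rule: finite_induct) (auto intro: set_algebra_empty set_algebra_union)

lemma set_algebra_least:
  assumes "s \<in> set_algebra G" "G \<subseteq> set_algebra H"
  shows "s \<in> set_algebra H"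
  using assms by induction (auto intro: set_algebra.intros)

lemma set_algebra_mono:
  assumes "G \<subseteq> H"
  shows "set_algebra G \<subseteq> set_algebra H"
  using assms by (meson set_algebra.base set_algebra_least subset_iff)

text \<open>A term in the Boolean operations mentions only finitely many generators. Hence countably
  many elements involve only countably many indices, and these have a common upper bound in an order
  of type \<open>\<omega>\<^sub>1\<close>.\<close>

lemma set_algebra_finite_generators:
  assumes "s \<in> set_algebra (C \<union> a ` I)"
  obtains J where "finite J" "J \<subseteq> I" "s \<in> set_algebra (C \<union> a ` J)"
proof -
  have "\<exists>J. finite J \<and> J \<subseteq> I \<and> s \<in> set_algebra (C \<union> a ` J)"
    using assms
  proof induction
    case UNIV
    then show ?case by (intro exI[of _ "{}"]) (auto intro: set_algebra.UNIV)
  next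
    case (base g)
    then consider "g \<in> C" | i where "i \<in> I" "g = a i" by blast
    then show ?case
    proof cases
      case 1
      then show ?thesis by (intro exI[of _ "{}"]) (auto intro: set_algebra.base)
    next
      case 2
      then show ?thesis by (intro exI[of _ "{i}"]) (auto intro: set_algebra.base)
    qed
  next
    case (compl s)
    then show ?case by (blast intro: set_algebra.compl)
  next
    case (inter s t)
    then obtain J K where JK: "finite J" "J \<subseteq> I" "s \<in> set_algebra (C \<union> a ` J)"
      "finite K" "K \<subseteq> I" "t \<in> set_algebra (C \<union> a ` K)" by blast
    have "s \<in> set_algebra (C \<union> a ` (J \<union> K))" "t \<in> set_algebra (C \<union> a ` (J \<union> K))"
      using JK(3,6) set_algebra_mono[of "C \<union> a ` J" "C \<union> a ` (J \<union> K)"]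
        set_algebra_mono[of "C \<union> a ` K" "C \<union> a ` (J \<union> K)"] by blast+
    then have "s \<inter> t \<in> set_algebra (C \<union> a ` (J \<union> K))"
      by (rule set_algebra.inter)
    then show ?case using JK by (intro exI[of _ "J \<union> K"]) auto
  qed
  then show ?thesis using that by blast
qed

text \<open>The operations are applied stage by stage, and each stage stays countable. The stages
  increase, so any two sets occur in a common one and the union of all stages is closed.\<close>

lemma countable_set_algebra:
  assumes "countable G"
  shows "countable (set_algebra G)"
proof -
  define step where "step F = F \<union> uminus ` F \<union> (\<lambda>(s, t). s \<inter> t) ` (F \<times> F)" for F :: "'a set set"
  define F where "F n = (step ^^ n) (insert UNIV G)" for n
  have Suc: "F (Suc n) = step (F n)" for n by (simp add: F_def)
  have "countable (F n)" for n
    by (induction n) (use assms in \<open>auto simp: F_def step_def\<close>)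
  moreover have "set_algebra G \<subseteq> (\<Union>n. F n)"
  proof
    have "mono F"
      by (rule incseq_SucI) (auto simp: Suc step_def)
    fix s assume "s \<in> set_algebra G"
    then show "s \<in> (\<Union>n. F n)"
    proof induction
      case UNIV
      have "UNIV \<in> F 0" by (simp add: F_def)
      then show ?case by blast
    next
      case (base g)
      then have "g \<in> F 0" by (simp add: F_def)
      then show ?case by blast
    next
      case (compl s)
      then obtain n where "s \<in> F n" by blast
      then have "- s \<in> F (Suc n)" by (auto simp: Suc step_def)
      then show ?case by blast
    next
      case (inter s t)
      then obtain m n where "s \<in> F m" "t \<in> F n" by blast
      then have "s \<in> F (max m n)" "t \<in> F (max m n)"
        using monoD[OF \<open>mono F\<close>, of m "max m n"] monoD[OF \<open>mono F\<close>, of n "max m n"] by auto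
      then have "s \<inter> t \<in> F (Suc (max m n))"
        unfolding Suc step_def by (blast intro: image_eqI[where x = "(s, t)"])
      then show ?case by blast
    qed
  qed
  ultimately show ?thesis
    by (meson countable_UN countable_subset uncountable_def countableI_type)
qed

section \<open>Sets nearly independent of a countable family\<close>

text \<open>Outer regularity supplies an open \<open>U\<close> above \<open>S\<close> of nearly the
  same measure. The countable basis writes \<open>U\<close> as a countable union, whose finite
  subunions lie in the algebra and exhaust \<open>U\<close> in measure; each approximation costs
  \<open>e / 2\<close>.\<close>

lemma borel_approx_set_algebra:
  fixes M :: "'a::polish_space measure"
  assumes M: "finite_measure M" "sets M = sets borel"
    and B: "topological_basis B" "countable B"
    and S: "S \<in> sets M" and "0 < (e::real)"
  obtains c where "c \<in> set_algebra B" "measure M (sym_diff S c) < e"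
proof -
  interpret finite_measure M by fact
  have oM: "U \<in> sets M" if "open U" for U using that M(2) by simp
  have "emeasure M S = (INF U \<in> {U. S \<subseteq> U \<and> open U}. emeasure M U)"
    by (rule outer_regular) (use M S in auto)
  moreover have "emeasure M S < emeasure M S + ennreal (e / 2)"
    using \<open>0 < e\<close> emeasure_finite[of S] by (simp add: ennreal_add_left_cancel_less[of _ 0, simplified] top.not_eq_extremum)
  ultimately obtain U where U: "S \<subseteq> U" "open U" "emeasure M U < emeasure M S + ennreal (e / 2)"
    by (auto simp: INF_less_iff)
  then have US: "measure M U < measure M S + e / 2"
    using \<open>0 < e\<close> by (simp add: emeasure_eq_measure ennreal_less_iff flip: ennreal_plus)
  obtain B' where B': "B' \<subseteq> B" "\<Union>B' = U"
    using B(1) U(2) unfolding topological_basis_def by metis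
  define f where "f n = (\<Union>s\<in>{s\<in>B'. to_nat_on B' s < n}. s)" for n
  have cB': "countable B'" using B' B(2) countable_subset by blast
  have fin: "finite {s\<in>B'. to_nat_on B' s < n}" for n
    by (rule finite_imageD[of "to_nat_on B'"])
      (auto intro: finite_subset[of _ "{..<n}"] inj_on_subset[OF inj_on_to_nat_on[OF cB']])
  have fB: "f n \<in> set_algebra B" for n
    unfolding f_def using fin B' by (intro set_algebra_UN) (auto intro: set_algebra.base)
  have fU: "(\<Union>n. f n) = U" using B'(2) by (auto simp: f_def)
  have fM: "f n \<in> sets M" for n
    unfolding f_def using topological_basis_open[OF B(1)] B'(1) by (intro oM open_UN) auto
  have "(\<lambda>n. measure M (f n)) \<longlonglongrightarrow> measure M (\<Union>n. f n)"
  proof (rule finite_Lim_measure_incseq)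
    show "range f \<subseteq> sets M" using fM by auto
    show "incseq f" by (force simp: f_def incseq_def)
  qed
  then have "\<forall>\<^sub>F n in sequentially. measure M U - e / 2 < measure M (f n)"
    using \<open>0 < e\<close> by (intro order_tendstoD(1)) (auto simp: fU)
  then obtain n where n: "measure M U - e / 2 < measure M (f n)"
    by (auto dest: eventually_happens)
  have "measure M (sym_diff S (f n)) \<le> measure M ((U - f n) \<union> (U - S))"
    using U(1) fU fM S oM[OF U(2)] by (intro finite_measure_mono) auto
  also have "\<dots> \<le> measure M (U - f n) + measure M (U - S)"
    using fM S oM[OF U(2)] by (intro measure_Un_le) auto
  also have "\<dots> = (measure M U - measure M (f n)) + (measure M U - measure M S)"
    using fM S oM[OF U(2)] U(1) fU by (subst (1 2) finite_measure_Diff) auto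
  also have "\<dots> < e" using n US by simp
  finally show ?thesis using that fB by blast
qed

text \<open>Outer regularity at a null singleton gives every point an open neighbourhood of measure
  below \<open>e\<close>. By the Lindelof property countably many of these cover the space, so one
  of them meets the non-null \<open>S\<close> in positive measure.\<close>

lemma nonatomic_small_subset:
  fixes M :: "'a::polish_space measure"
  assumes M: "finite_measure M" "sets M = sets borel" and atom: "\<And>x. measure M {x} = 0"
    and S: "S \<in> sets M" "measure M S > 0" and "0 < (e::real)"
  obtains b where "b \<in> sets M" "b \<subseteq> S" "0 < measure M b" "measure M b < e"
proof -
  interpret finite_measure M by fact
  define \<F> where "\<F> = {U. open U \<and> measure M U < e}"
  have "\<exists>U\<in>\<F>. x \<in> U" for x
  proof -
    have "emeasure M {x} = (INF U \<in> {U. {x} \<subseteq> U \<and> open U}. emeasure M U)"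
      by (rule outer_regular) (use M in auto)
    moreover have "emeasure M {x} < ennreal e"
      using \<open>0 < e\<close> atom by (simp add: emeasure_eq_measure)
    ultimately obtain U where "x \<in> U" "open U" "emeasure M U < ennreal e"
      by (auto simp: INF_less_iff)
    then show ?thesis
      by (auto simp: \<F>_def emeasure_eq_measure ennreal_less_iff)
  qed
  then have cover: "\<Union>\<F> = UNIV" by auto
  obtain \<G> where \<G>: "\<G> \<subseteq> \<F>" "countable \<G>" "\<Union>\<G> = \<Union>\<F>"
    using Lindelof[of \<F>] by (auto simp: \<F>_def)
  have \<G>M: "S \<inter> U \<in> sets M" if "U \<in> \<G>" for U
    using that \<G>(1) S(1) M(2) by (auto simp: \<F>_def)
  have "\<exists>U\<in>\<G>. measure M (S \<inter> U) > 0"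
  proof (rule ccontr)
    assume "\<not> ?thesis"
    then have "S \<inter> U \<in> null_sets M" if "U \<in> \<G>" for U
      using that \<G>M[OF that]
      by (metis emeasure_eq_measure ennreal_0 null_setsI zero_less_measure_iff)
    then have "(\<Union>U\<in>\<G>. S \<inter> U) \<in> null_sets M" using \<G>(2) by (intro null_sets_UN') auto
    moreover have "(\<Union>U\<in>\<G>. S \<inter> U) = S" using \<G>(3) cover by auto
    ultimately show False using S(2) by (simp add: measure_eq_0_null_sets)
  qed
  then obtain U where U: "U \<in> \<G>" "measure M (S \<inter> U) > 0" by blast
  have "measure M (S \<inter> U) \<le> measure M U"
    using U \<G>(1) M(2) by (intro finite_measure_mono) (auto simp: \<F>_def)
  also have "\<dots> < e" using U \<G>(1) by (auto simp: \<F>_def)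
  finally show ?thesis using that[of "S \<inter> U"] U \<G>M by auto
qed

text \<open>Each \<open>W s\<close> discards the points where \<open>s\<close> differs from its
  approximation \<open>c s\<close>, which equates their traces on \<open>a\<close>, together with a
  part \<open>b s\<close> of \<open>s\<close>, which keeps a non-null \<open>s\<close> from lying
  almost inside \<open>a\<close>.\<close>

lemma exists_set_tracing_countable_family:
  fixes M :: "'a::polish_space measure"
  assumes M: "prob_space M" "sets M = sets borel" and atom: "\<And>x. measure M {x} = 0"
    and B: "topological_basis B" "countable B"
    and S: "countable S" "S \<subseteq> sets M"
  shows "\<exists>a\<in>sets M. 0 < measure M a \<and> (\<forall>s\<in>S. \<exists>c\<in>set_algebra B. a \<inter> s = a \<inter> c)
    \<and> (\<forall>s\<in>S. 0 < measure M s \<longrightarrow> 0 < measure M (s - a))"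
proof -
  interpret prob_space M by fact
  \<comment> \<open>With offset 3, \<open>W s\<close> has measure at most \<open>2 * e s\<close>,
    which is \<open>(1 / 2) ^ (n + 2)\<close> for \<open>n\<close> the code of \<open>s\<close>.
    These bounds sum to \<open>1 / 2\<close>, so \<open>a\<close> keeps at least half of the
    measure.\<close>
  define e where "e s = (1 / 2 :: real) ^ (to_nat_on S s + 3)" for s
  have e0: "0 < e s" for s by (simp add: e_def)
  have "\<exists>c\<in>set_algebra B. measure M (sym_diff s c) < e s" if "s \<in> S" for s
    using borel_approx_set_algebra[OF finite_measure_axioms M(2) B, of s "e s"] S that e0 by blast
  then obtain c where c: "\<And>s. s \<in> S \<Longrightarrow> c s \<in> set_algebra B"
    "\<And>s. s \<in> S \<Longrightarrow> measure M (sym_diff s (c s)) < e s" by metis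
  have "\<exists>b\<in>sets M. b \<subseteq> s \<and> measure M b < e s \<and> (0 < measure M s \<longrightarrow> 0 < measure M b)"
    if "s \<in> S" for s
  proof (cases "0 < measure M s")
    case True
    have "s \<in> sets M" using S(2) that by blast
    from nonatomic_small_subset[OF finite_measure_axioms M(2) atom this True e0[of s]]
    obtain b where "b \<in> sets M" "b \<subseteq> s" "0 < measure M b" "measure M b < e s" by blast
    then show ?thesis by blast
  qed (use e0 in \<open>auto intro!: bexI[of _ "{}"]\<close>)
  then obtain b where b: "\<And>s. s \<in> S \<Longrightarrow> b s \<in> sets M" "\<And>s. s \<in> S \<Longrightarrow> b s \<subseteq> s"
    "\<And>s. s \<in> S \<Longrightarrow> measure M (b s) < e s"
    "\<And>s. s \<in> S \<Longrightarrow> 0 < measure M s \<Longrightarrow> 0 < measure M (b s)" by metis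
  have "set_algebra B \<subseteq> sets M"
  proof
    fix s assume "s \<in> set_algebra B"
    then show "s \<in> sets M"
      by induction (use M(2) topological_basis_open[OF B(1)] in auto)
  qed
  then have cM: "c s \<in> sets M" if "s \<in> S" for s using c that by auto
  define W where "W s = sym_diff s (c s) \<union> b s" for s
  have WM: "W s \<in> sets M" if "s \<in> S" for s
    using that S(2) cM b(1) by (auto simp: W_def)
  have Wle: "measure M (W s) \<le> 2 * e s" if "s \<in> S" for s
  proof -
    have "measure M (W s) \<le> measure M (sym_diff s (c s)) + measure M (b s)"
      unfolding W_def using that S(2) cM b(1) by (intro measure_Un_le) auto
    then show ?thesis using c(2)[OF that] b(3)[OF that] by linarith
  qed
  \<comment> \<open>Reindexing by the natural numbers makes the series bound available; a number
    that codes no member of \<open>S\<close> contributes the empty set.\<close>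
  define V where "V n = (\<Union>s\<in>{s\<in>S. to_nat_on S s = n}. W s)" for n
  have V: "V n \<in> sets M \<and> measure M (V n) \<le> (1 / 2) ^ (n + 2)" for n
  proof (cases "\<exists>s\<in>S. to_nat_on S s = n")
    case True
    then obtain s where s: "s \<in> S" "to_nat_on S s = n" by blast
    then have "{s\<in>S. to_nat_on S s = n} = {s}"
      using inj_on_to_nat_on[OF S(1)] by (auto dest: inj_onD)
    then have "V n = W s" by (simp add: V_def)
    then show ?thesis using WM Wle[of s] s by (auto simp: e_def power_add power3_eq_cube power2_eq_square)
  next
    case False
    then have "V n = {}" by (auto simp: V_def)
    then show ?thesis by simp
  qed
  have sm: "summable (\<lambda>n. (1 / 2 :: real) ^ (n + 2))"
    by (auto simp: power_add intro!: summable_mult2 summable_geometric)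
  have smV: "summable (\<lambda>n. measure M (V n))"
    by (rule summable_comparison_test'[OF sm, of 0]) (use V in auto)
  have "measure M (\<Union>n. V n) \<le> (\<Sum>n. measure M (V n))"
    using V smV by (intro finite_measure_subadditive_countably) auto
  also have "\<dots> \<le> (\<Sum>n. (1 / 2) ^ (n + 2))"
    using V sm smV by (intro suminf_le) auto
  also have "\<dots> = 1 / 2"
    using suminf_geometric[of "1 / 2 :: real"] suminf_mult2[OF summable_geometric[of "1 / 2 :: real"], of "1/4"]
    by (simp add: power_add power2_eq_square)
  finally have half: "measure M (\<Union>n. V n) \<le> 1 / 2" .
  have VM: "(\<Union>n. V n) \<in> sets M" using V by blast
  define a where "a = - (\<Union>n. V n)"
  have sp: "space M = UNIV" using sets_eq_imp_space_eq[OF M(2)] by simp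
  have aM: "a \<in> sets M"
    using VM sets.compl_sets[OF VM] by (simp add: a_def sp Compl_eq_Diff_UNIV)
  have "measure M a = 1 - measure M (\<Union>n. V n)"
    using prob_compl[OF VM] by (simp add: a_def sp Compl_eq_Diff_UNIV)
  then have "0 < measure M a" using half by simp
  moreover have aW: "a \<inter> W s = {}" if "s \<in> S" for s
    using that by (auto simp: a_def V_def)
  have "a \<inter> s = a \<inter> c s" if "s \<in> S" for s
    using aW[OF that] by (auto simp: W_def)
  moreover have "0 < measure M (s - a)" if "s \<in> S" "0 < measure M s" for s
  proof -
    have "measure M (b s) \<le> measure M (s - a)"
      using aW[OF that(1)] b(2)[OF that(1)] aM S(2) that(1)
      by (intro finite_measure_mono) (auto simp: W_def)
    then show ?thesis using b(4)[OF that] by linarith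
  qed
  ultimately show ?thesis using c aM by blast
qed

section \<open>Separability from traces on a countable algebra\<close>

text \<open>A well-order of type \<open>\<omega>\<^sub>1\<close> on \<open>I\<close>, presented by
  the sets \<open>P i\<close> of strict predecessors. Transitivity on \<open>I\<close> follows from
  totality and well-foundedness.\<close>

locale omega1_order =
  fixes I :: "'i set" and P :: "'i \<Rightarrow> 'i set"
  assumes uncountable_index: "uncountable I"
    and pred_subset: "i \<in> I \<Longrightarrow> P i \<subseteq> I"
    and countable_pred: "countable (P i)"
    and total_pred: "\<lbrakk>i \<in> I; j \<in> I\<rbrakk> \<Longrightarrow> i \<in> P j \<or> i = j \<or> j \<in> P i"
    and wf_pred: "wf {(j, i). j \<in> P i}"
begin

text \<open>By totality, an index that is not above all of \<open>J\<close> belongs to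
  \<open>J\<close> or precedes a member of \<open>J\<close>, and only countably many indices
  do.\<close>

lemma uncountable_above:
  assumes "uncountable H" "H \<subseteq> I" "countable J" "J \<subseteq> I"
  shows "uncountable {i \<in> H. J \<subseteq> P i}"
proof
  assume "countable {i \<in> H. J \<subseteq> P i}"
  moreover have "countable (J \<union> (\<Union>j\<in>J. P j))"
    using assms(3) countable_pred by auto
  moreover have "H \<subseteq> {i \<in> H. J \<subseteq> P i} \<union> (J \<union> (\<Union>j\<in>J. P j))"
    using total_pred assms(2,4) by blast
  ultimately show False
    using assms(1) countable_subset countable_Un by metis
qed

end

text \<open>The cardinal successor of \<open>natLeq\<close> serves: a proper initial segment of a
  cardinal is strictly smaller, hence here countable. The elements are of type
  \<open>nat set\<close> because \<open>cardSuc\<close> orders sets over the original type.\<close>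

lemma exists_omega1_order:
  obtains I :: "nat set set" and P where "omega1_order I P"
proof
  let ?r = "cardSuc natLeq"
  have card: "Card_order ?r" by (rule cardSuc_Card_order[OF natLeq_Card_order])
  then have wo: "Well_order ?r" unfolding card_order_on_def by blast
  have cnt: "countable (underS ?r i)" for i
  proof (cases "i \<in> Field ?r")
    case True
    then show ?thesis
      unfolding countable_card_le_natLeq
      by (intro cardSuc_ordLeq_ordLess[THEN iffD1] natLeq_Card_order card_of_Card_order
          card_of_underS card)
  next
    case False
    then have "underS ?r i = {}" by (auto simp: underS_def Field_def)
    then show ?thesis by simp
  qed
  show "omega1_order (Field ?r) (underS ?r)"
  proof
    show "uncountable (Field ?r)"
    proof
      assume "countable (Field ?r)"
      then have "ordLeq3 (card_of (Field ?r)) natLeq" by (simp add: countable_card_le_natLeq)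
      then have "ordLeq3 ?r natLeq"
        using card_of_Field_ordIso[OF card] ordIso_ordLeq_trans ordIso_symmetric by blast
      then show False
        using cardSuc_greater[OF natLeq_Card_order] not_ordLess_ordLeq by blast
    qed
    show "underS ?r i \<subseteq> Field ?r" for i by (auto simp: underS_def Field_def)
    show "countable (underS ?r i)" for i by (rule cnt)
    show "i \<in> underS ?r j \<or> i = j \<or> j \<in> underS ?r i" if "i \<in> Field ?r" "j \<in> Field ?r" for i j
      using wo_rel.TOTALS[of ?r] wo that by (auto simp: wo_rel_def underS_def)
    have "{(j, i). j \<in> underS ?r i} = ?r - Id" by (auto simp: underS_def)
    then show "wf {(j, i). j \<in> underS ?r i}" using wo by (simp add: well_order_on_def)
  qed
qed

text \<open>Records the trace property apart from the measure \<open>M\<close>, since the density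
  result is about arbitrary finitely additive functionals.\<close>

locale traced_family = omega1_order I P for I :: "'i set" and P +
  fixes G :: "'a set set" and a :: "'i \<Rightarrow> 'a set"
  assumes countable_gen: "countable G"
    and trace: "\<lbrakk>i \<in> I; s \<in> set_algebra (G \<union> a ` P i)\<rbrakk> \<Longrightarrow> \<exists>c\<in>set_algebra G. a i \<inter> s = a i \<inter> c"
begin

definition alg :: "'i set \<Rightarrow> 'a set set" where
  "alg J = set_algebra (G \<union> a ` J)"

lemma alg_mono: "J \<subseteq> K \<Longrightarrow> alg J \<subseteq> alg K"
  unfolding alg_def by (intro set_algebra_mono) auto

lemma gen_alg: "set_algebra G \<subseteq> alg J"
  unfolding alg_def by (intro set_algebra_mono) auto

lemma in_alg: "i \<in> J \<Longrightarrow> a i \<in> alg J"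
  unfolding alg_def by (intro set_algebra.base) auto

lemma alg_finite:
  assumes "s \<in> alg I"
  obtains J where "finite J" "J \<subseteq> I" "s \<in> alg J"
  using assms set_algebra_finite_generators unfolding alg_def by metis

lemma alg_closed:
  "UNIV \<in> alg J" "s \<in> alg J \<Longrightarrow> - s \<in> alg J"
  "\<lbrakk>s \<in> alg J; t \<in> alg J\<rbrakk> \<Longrightarrow> s \<inter> t \<in> alg J"
  "\<lbrakk>s \<in> alg J; t \<in> alg J\<rbrakk> \<Longrightarrow> s \<union> t \<in> alg J"
  "\<lbrakk>s \<in> alg J; t \<in> alg J\<rbrakk> \<Longrightarrow> s - t \<in> alg J"
  unfolding alg_def
  by (auto intro: set_algebra.intros set_algebra_union set_algebra_diff)

lemma countable_alg: "countable J \<Longrightarrow> countable (alg J)"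
  unfolding alg_def using countable_gen by (intro countable_set_algebra) auto

text \<open>A measure \<open>\<mu>\<close> on the quotient enters as the function taking a set
  \<open>s\<close> to \<open>\<mu> (rep s)\<close>. On sets the trace property applies directly; the
  distance \<open>\<nu> (sym_diff s t)\<close> is in general only a pseudometric.\<close>

context
  fixes \<nu> :: "'a set \<Rightarrow> real"
  assumes nonneg: "s \<in> alg I \<Longrightarrow> 0 \<le> \<nu> s"
    and additive: "\<lbrakk>s \<in> alg I; t \<in> alg I; s \<inter> t = {}\<rbrakk> \<Longrightarrow> \<nu> (s \<union> t) = \<nu> s + \<nu> t"
begin

lemma additive_diff:
  assumes "s \<in> alg I" "t \<in> alg I" "t \<subseteq> s"
  shows "\<nu> (s - t) = \<nu> s - \<nu> t"
proof -
  have "s - t \<union> t = s" "(s - t) \<inter> t = {}" using assms(3) by auto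
  then show ?thesis using additive[of "s - t" t] assms(1,2) alg_closed(5) by simp
qed

lemma additive_mono:
  assumes "s \<in> alg I" "t \<in> alg I" "t \<subseteq> s"
  shows "\<nu> t \<le> \<nu> s"
  using additive_diff[OF assms] nonneg[of "s - t"] assms alg_closed by auto

lemma additive_sub:
  assumes "s \<in> alg I" "t \<in> alg I"
  shows "\<nu> (s \<union> t) \<le> \<nu> s + \<nu> t"
  using additive[of s "t - s"] additive_mono[of t "t - s"] assms alg_closed by auto

text \<open>Take \<open>b\<close> of nearly least measure among the elements lying above uncountably many of the
  exceptional \<open>a j\<close>. Replacing \<open>b\<close> by the points of \<open>b\<close> at which \<open>a i\<close> and the trace \<open>c\<close> agree
  still leaves an element above uncountably many \<open>a j\<close>, so what is removed, \<open>a i\<close> against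
  \<open>b \<inter> c\<close>, is small.\<close>

lemma countable_far_from_predecessors:
  assumes "0 < e"
  shows "countable {i \<in> I. \<forall>d\<in>alg (P i). e \<le> \<nu> (sym_diff (a i) d)}" (is "countable ?H")
proof (rule ccontr)
  assume H: "uncountable ?H"
  define Q where "Q = {b \<in> alg I. uncountable {i \<in> ?H. a i \<subseteq> b}}"
  have "UNIV \<in> Q" using H alg_closed(1) by (simp add: Q_def)
  have bdd: "bdd_below (\<nu> ` Q)"
    by (rule bdd_belowI[of _ 0]) (auto simp: Q_def nonneg)
  have "\<exists>b\<in>Q. \<nu> b < Inf (\<nu> ` Q) + e"
    using cInf_lessD[of "\<nu> ` Q" "Inf (\<nu> ` Q) + e"] \<open>UNIV \<in> Q\<close> \<open>0 < e\<close> by auto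
  then obtain b where b: "b \<in> Q" "\<nu> b < Inf (\<nu> ` Q) + e" by blast
  then have bI: "b \<in> alg I" by (simp add: Q_def)
  \<comment> \<open>For an index \<open>i\<close> beyond the finite support \<open>J\<close>, the
    set \<open>b\<close> lies in the algebra of the predecessors of \<open>i\<close>, and so does
    the later approximant \<open>b \<inter> c\<close>.\<close>
  obtain J where J: "finite J" "J \<subseteq> I" "b \<in> alg J" using alg_finite[OF bI] .
  let ?Hb = "{i \<in> ?H. a i \<subseteq> b}"
  have Hb: "uncountable ?Hb" using b(1) by (simp add: Q_def)
  then have "uncountable {i \<in> ?Hb. J \<subseteq> P i}"
    by (rule uncountable_above) (use J in \<open>auto intro: countable_finite\<close>)
  then have "{i \<in> ?Hb. J \<subseteq> P i} \<noteq> {}" by (metis countable_empty)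
  then obtain i where i: "i \<in> ?Hb" "J \<subseteq> P i" by blast
  then have iI: "i \<in> I" by simp
  have bi: "b \<in> alg (P i)" using J(3) alg_mono[OF i(2)] by blast
  \<comment> \<open>For \<open>j\<close> after \<open>i\<close>, the set \<open>a i\<close> is among
    those whose trace on \<open>a j\<close> is controlled.\<close>
  define K where "K = {j \<in> ?Hb. {i} \<subseteq> P j}"
  have K: "uncountable K"
    unfolding K_def using Hb by (rule uncountable_above) (use iI in auto)
  have "\<exists>c\<in>set_algebra G. a j \<inter> a i = a j \<inter> c" if "j \<in> K" for j
  proof (rule trace)
    show "j \<in> I" using that by (simp add: K_def)
    show "a i \<in> set_algebra (G \<union> a ` P j)"
      using that by (intro set_algebra.base) (simp add: K_def)
  qed
  then have KU: "K \<subseteq> (\<Union>c\<in>set_algebra G. {j \<in> K. a j \<inter> a i = a j \<inter> c})" by auto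
  \<comment> \<open>Pigeonhole: uncountably many \<open>j\<close> and only countably many traces
    \<open>c\<close>.\<close>
  have "\<exists>c\<in>set_algebra G. uncountable {j \<in> K. a j \<inter> a i = a j \<inter> c}"
  proof (rule ccontr)
    assume "\<not> ?thesis"
    then have "countable (\<Union>c\<in>set_algebra G. {j \<in> K. a j \<inter> a i = a j \<inter> c})"
      by (intro countable_UN countable_set_algebra countable_gen) simp
    then show False using K countable_subset[OF KU] by simp
  qed
  then obtain c where c: "c \<in> set_algebra G" "uncountable {j \<in> K. a j \<inter> a i = a j \<inter> c}" ..
  have cI: "c \<in> alg I" "c \<in> alg (P i)" using c(1) gen_alg by blast+
  have aI: "a i \<in> alg I" using iI by (rule in_alg)
  define b' where "b' = (b \<inter> (a i \<inter> c)) \<union> (b - (a i \<union> c))"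
  have b'I: "b' \<in> alg I"
    unfolding b'_def using bI cI aI by (intro alg_closed) auto
  have "{j \<in> K. a j \<inter> a i = a j \<inter> c} \<subseteq> {j \<in> ?H. a j \<subseteq> b'}"
  proof clarify
    fix j assume j: "j \<in> K" "a j \<inter> a i = a j \<inter> c"
    then have "a j \<subseteq> b'" unfolding b'_def K_def by blast
    then show "j \<in> ?H \<and> a j \<subseteq> b'" using j(1) by (simp add: K_def)
  qed
  then have "uncountable {j \<in> ?H. a j \<subseteq> b'}"
    using c(2) by (meson countable_subset)
  then have "b' \<in> Q"
    using b'I unfolding Q_def by simp
  \<comment> \<open>Membership in \<open>Q\<close> keeps \<open>\<nu> b'\<close> at or above the
    infimum, so near-minimality of \<open>b\<close> leaves less than \<open>e\<close> for
    \<open>b - b'\<close>.\<close>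
  then have "\<nu> b < \<nu> b' + e"
    using cINF_lower[OF bdd, of b'] b(2) by simp
  then have "\<nu> (b - b') < e"
    using additive_diff[OF bI b'I] unfolding b'_def by auto
  \<comment> \<open>As \<open>a i\<close> lies inside \<open>b\<close>, the points of
    \<open>b\<close> where \<open>a i\<close> and \<open>c\<close> disagree are exactly those
    separating \<open>a i\<close> from \<open>b \<inter> c\<close>.\<close>
  moreover have "b - b' = sym_diff (a i) (b \<inter> c)" using i(1) by (auto simp: b'_def)
  moreover have "b \<inter> c \<in> alg (P i)" using bi cI(2) by (rule alg_closed)
  ultimately show False using i(1) by (auto simp flip: not_less)
qed

text \<open>The countable algebra generated over \<open>G\<close> by the exceptional
  \<open>a i\<close> is dense. By induction along the order each \<open>a i\<close> is in its
  closure, a non-exceptional one being a limit of elements of the algebra preceding it.\<close>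

lemma exists_countable_dense:
  "\<exists>D. countable D \<and> D \<subseteq> alg I \<and> (\<forall>s\<in>alg I. \<forall>e>0. \<exists>d\<in>D. \<nu> (sym_diff s d) < e)"
proof -
  define H where "H = (\<Union>n. {i \<in> I. \<forall>d\<in>alg (P i). 1 / real (Suc n) \<le> \<nu> (sym_diff (a i) d)})"
  have H: "countable H" "H \<subseteq> I"
    unfolding H_def using countable_far_from_predecessors by auto
  \<comment> \<open>The closure of \<open>alg H\<close>. Complements preserve distances and
    intersections at most add them, so it is again an algebra and need only contain the
    generators.\<close>
  define adh where "adh = {s \<in> alg I. \<forall>e>0. \<exists>d\<in>alg H. \<nu> (sym_diff s d) < e}"
  have sub: "alg H \<subseteq> alg I" using alg_mono[OF H(2)] .
  have dI: "d \<in> alg I" if "d \<in> alg H" for d using sub that by blast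
  have refl: "alg H \<subseteq> adh"
  proof
    fix s assume "s \<in> alg H"
    moreover have "\<nu> {} = 0"
      using additive[of "{}" "{}"] alg_closed(2)[OF alg_closed(1)] by simp
    ultimately show "s \<in> adh"
      using dI by (auto simp: adh_def intro!: bexI[of _ s])
  qed
  have compl: "- s \<in> adh" if "s \<in> adh" for s
  proof -
    have "\<exists>d\<in>alg H. \<nu> (sym_diff (- s) d) < e" if "e > 0" for e
    proof -
      obtain d where d: "d \<in> alg H" "\<nu> (sym_diff s d) < e"
        using \<open>s \<in> adh\<close> \<open>e > 0\<close> unfolding adh_def by blast
      moreover have "sym_diff (- s) (- d) = sym_diff s d" by blast
      ultimately show ?thesis
        using alg_closed(2)[OF d(1)] by (intro bexI[of _ "- d"]) simp_all
    qed
    then show ?thesis using that alg_closed(2) by (simp add: adh_def)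
  qed
  have inter: "s \<inter> t \<in> adh" if "s \<in> adh" "t \<in> adh" for s t
  proof -
    have st: "s \<in> alg I" "t \<in> alg I" using that by (auto simp: adh_def)
    have "\<exists>d\<in>alg H. \<nu> (sym_diff (s \<inter> t) d) < e" if "e > 0" for e
    proof -
      obtain d d' where d: "d \<in> alg H" "\<nu> (sym_diff s d) < e / 2"
        "d' \<in> alg H" "\<nu> (sym_diff t d') < e / 2"
        using \<open>s \<in> adh\<close> \<open>t \<in> adh\<close> half_gt_zero[OF \<open>e > 0\<close>] unfolding adh_def by blast
      have I: "d \<in> alg I" "d' \<in> alg I" using d dI by auto
      have "\<nu> (sym_diff (s \<inter> t) (d \<inter> d')) \<le> \<nu> (sym_diff s d \<union> sym_diff t d')"
        by (rule additive_mono) (intro alg_closed st I | blast)+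
      also have "\<dots> \<le> \<nu> (sym_diff s d) + \<nu> (sym_diff t d')"
        by (rule additive_sub) (intro alg_closed st I)+
      also have "\<dots> < e" using d by linarith
      finally show ?thesis using alg_closed(3)[OF d(1,3)] by blast
    qed
    then show ?thesis using st alg_closed(3) by (simp add: adh_def)
  qed
  have adh_closed: "set_algebra F \<subseteq> adh" if "F \<subseteq> adh" for F
  proof
    fix s assume "s \<in> set_algebra F"
    then show "s \<in> adh"
      by induction (use that refl alg_closed(1) compl inter in auto)
  qed
  have gen_adh: "G \<subseteq> adh"
    using gen_alg[of H] refl set_algebra.base by blast
  have a_adh: "i \<in> I \<longrightarrow> a i \<in> adh" for i
    using wf_pred
  proof (induction i rule: wf_induct_rule)
    case (less i)
    show ?case
    proof
      assume i: "i \<in> I"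
      have IH: "alg (P i) \<subseteq> adh"
        unfolding alg_def using less pred_subset[OF i] gen_adh by (intro adh_closed) auto
      show "a i \<in> adh"
      proof (cases "i \<in> H")
        case True
        then show ?thesis using refl in_alg by blast
      next
        case False
        have "\<exists>d\<in>alg H. \<nu> (sym_diff (a i) d) < e" if "e > 0" for e
        proof -
          obtain n where n: "1 / real (Suc n) < e / 2"
            using nat_approx_posE[of "e / 2"] \<open>e > 0\<close> by auto
          obtain s where s: "s \<in> alg (P i)" "\<nu> (sym_diff (a i) s) < 1 / real (Suc n)"
            using False i unfolding H_def by (auto simp: not_le)
          obtain d where d: "d \<in> alg H" "\<nu> (sym_diff s d) < e / 2"
            using IH s(1) half_gt_zero[OF \<open>e > 0\<close>] unfolding adh_def by blast
          have I: "a i \<in> alg I" "s \<in> alg I" "d \<in> alg I"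
            using in_alg[OF i] IH s(1) dI[OF d(1)] by (auto simp: adh_def)
          have "\<nu> (sym_diff (a i) d) \<le> \<nu> (sym_diff (a i) s \<union> sym_diff s d)"
            by (rule additive_mono) (intro alg_closed I | blast)+
          also have "\<dots> \<le> \<nu> (sym_diff (a i) s) + \<nu> (sym_diff s d)"
            by (rule additive_sub) (intro alg_closed I)+
          also have "\<dots> < e" using d s n by linarith
          finally show ?thesis using d(1) by blast
        qed
        then show ?thesis using in_alg[OF i] by (simp add: adh_def)
      qed
    qed
  qed
  have "alg I \<subseteq> adh"
    unfolding alg_def using a_adh gen_adh by (intro adh_closed) auto
  then show ?thesis
    using countable_alg[OF H(1)] sub by (intro exI[of _ "alg H"]) (auto simp: adh_def)
qed

end

end

section \<open>The quotient by the null ideal\<close>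

text \<open>A class modulo null sets is represented by one chosen element of it.\<close>

definition null_rep :: "'a measure \<Rightarrow> 'a set set \<Rightarrow> 'a set \<Rightarrow> 'a set" where
  "null_rep M A s = (SOME t. t \<in> A \<and> sym_diff s t \<in> null_sets M)"

definition null_quotient :: "'a measure \<Rightarrow> 'a set set \<Rightarrow> 'a set bool_alg" where
  "null_quotient M A = \<lparr>elems = null_rep M A ` A, bmeet = (\<lambda>s t. null_rep M A (s \<inter> t)),
     bjoin = (\<lambda>s t. null_rep M A (s \<union> t)), bcompl = (\<lambda>s. null_rep M A (- s)),
     bzero = null_rep M A {}, bunit = null_rep M A UNIV\<rparr>"

lemma null_quotient_sel [simp]:
  "elems (null_quotient M A) = null_rep M A ` A"
  "bmeet (null_quotient M A) s t = null_rep M A (s \<inter> t)"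
  "bjoin (null_quotient M A) s t = null_rep M A (s \<union> t)"
  "bcompl (null_quotient M A) s = null_rep M A (- s)"
  "bzero (null_quotient M A) = null_rep M A {}"
  "bunit (null_quotient M A) = null_rep M A UNIV"
  by (simp_all add: null_quotient_def)

locale measured_set_algebra = prob_space M for M :: "'a measure" +
  fixes G :: "'a set set"
  assumes space_UNIV: "space M = UNIV"
    and gen_measurable: "G \<subseteq> sets M"
begin

abbreviation A where "A \<equiv> set_algebra G"

abbreviation rep where "rep \<equiv> null_rep M A"

abbreviation Q where "Q \<equiv> null_quotient M A"

lemma measurable: "s \<in> A \<Longrightarrow> s \<in> sets M"
proof (induction rule: set_algebra.induct)
  case UNIV
  show ?case using sets.top[of M] by (simp add: space_UNIV)
next
  case (base g)
  then show ?case using gen_measurable by blast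
next
  case (compl s)
  then show ?case using sets.compl_sets[of s M] by (simp add: space_UNIV Compl_eq_Diff_UNIV)
qed auto

lemma A_closed:
  "UNIV \<in> A" "{} \<in> A" "s \<in> A \<Longrightarrow> - s \<in> A"
  "\<lbrakk>s \<in> A; t \<in> A\<rbrakk> \<Longrightarrow> s \<inter> t \<in> A" "\<lbrakk>s \<in> A; t \<in> A\<rbrakk> \<Longrightarrow> s \<union> t \<in> A"
  "\<lbrakk>s \<in> A; t \<in> A\<rbrakk> \<Longrightarrow> s - t \<in> A"
  by (auto intro: set_algebra.intros set_algebra_empty set_algebra_union set_algebra_diff)

lemma null_subset:
  assumes "N \<in> null_sets M" "s \<in> A" "s \<subseteq> N"
  shows "s \<in> null_sets M"
  using assms null_sets_subset[OF assms(1) measurable] by blast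

lemma rep:
  assumes "s \<in> A"
  shows "rep s \<in> A" "sym_diff s (rep s) \<in> null_sets M"
proof -
  have "s \<in> A \<and> sym_diff s s \<in> null_sets M" using assms by simp
  then have "rep s \<in> A \<and> sym_diff s (rep s) \<in> null_sets M"
    unfolding null_rep_def by (rule someI)
  then show "rep s \<in> A" "sym_diff s (rep s) \<in> null_sets M" by auto
qed

lemma sym_diff_null_trans:
  assumes "s \<in> A" "t \<in> A" "sym_diff s u \<in> null_sets M" "sym_diff u t \<in> null_sets M"
  shows "sym_diff s t \<in> null_sets M"
proof (rule null_subset)
  show "sym_diff s u \<union> sym_diff u t \<in> null_sets M" using assms(3,4) by (rule null_sets.Un)
  show "sym_diff s t \<in> A" using assms by (intro A_closed)
qed auto

text \<open>Equivalent sets satisfy the same condition under \<open>SOME\<close>, so the choice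
  returns the same representative; equality of representatives thus encodes equality of
  classes.\<close>

lemma rep_eq_iff:
  assumes "s \<in> A" "t \<in> A"
  shows "rep s = rep t \<longleftrightarrow> sym_diff s t \<in> null_sets M"
proof
  assume "rep s = rep t"
  then show "sym_diff s t \<in> null_sets M"
    using sym_diff_null_trans[OF assms, of "rep s"] rep(2)[OF assms(1)] rep(2)[OF assms(2)]
    by (simp add: Un_commute)
next
  assume st: "sym_diff s t \<in> null_sets M"
  have "sym_diff s u \<in> null_sets M \<longleftrightarrow> sym_diff t u \<in> null_sets M" if "u \<in> A" for u
    using sym_diff_null_trans[of s u t] sym_diff_null_trans[of t u s] assms that st
    by (auto simp: Un_commute)
  then show "rep s = rep t"
    unfolding null_rep_def by (metis (no_types, lifting))
qed

lemma rep_rep: "s \<in> A \<Longrightarrow> rep (rep s) = rep s"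
  using rep[of s] rep_eq_iff[of "rep s" s] by (simp add: Un_commute)

lemma rep_compl: "s \<in> A \<Longrightarrow> rep (- rep s) = rep (- s)"
proof -
  assume s: "s \<in> A"
  have "sym_diff (- rep s) (- s) = sym_diff s (rep s)" by blast
  then show ?thesis using rep[OF s] s by (simp add: rep_eq_iff A_closed)
qed

lemma rep_inter1:
  assumes "s \<in> A" "t \<in> A"
  shows "rep (rep s \<inter> t) = rep (s \<inter> t)"
proof -
  have "sym_diff (rep s \<inter> t) (s \<inter> t) \<in> null_sets M"
    using rep(2)[OF assms(1)]
    by (rule null_subset) (intro A_closed assms rep | blast)+
  then show ?thesis using assms rep by (simp add: rep_eq_iff A_closed)
qed

lemma rep_union1:
  assumes "s \<in> A" "t \<in> A"
  shows "rep (rep s \<union> t) = rep (s \<union> t)"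
proof -
  have "sym_diff (rep s \<union> t) (s \<union> t) \<in> null_sets M"
    using rep(2)[OF assms(1)]
    by (rule null_subset) (intro A_closed assms rep | blast)+
  then show ?thesis using assms rep by (simp add: rep_eq_iff A_closed)
qed

lemma rep_inter2: "\<lbrakk>s \<in> A; t \<in> A\<rbrakk> \<Longrightarrow> rep (t \<inter> rep s) = rep (t \<inter> s)"
  using rep_inter1[of s t] by (simp add: Int_commute)

lemma rep_union2: "\<lbrakk>s \<in> A; t \<in> A\<rbrakk> \<Longrightarrow> rep (t \<union> rep s) = rep (t \<union> s)"
  using rep_union1[of s t] by (simp add: Un_commute)

text \<open>These rules erase inner occurrences of \<open>rep\<close>, reducing identities in the
  quotient to identities of sets.\<close>

lemmas rep_simps = rep_rep rep_compl rep_inter1 rep_inter2 rep_union1 rep_union2 A_closed rep(1)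

lemma measure_rep:
  assumes "s \<in> A"
  shows "measure M (rep s) = measure M s"
proof (rule measure_eq_AE)
  show "AE x in M. (x \<in> rep s) = (x \<in> s)"
    using rep(2)[OF assms] by (rule AE_I') auto
qed (use assms rep measurable in blast)+

lemma rep_eq_empty_iff:
  assumes "s \<in> A"
  shows "rep s = rep {} \<longleftrightarrow> measure M s = 0"
  using assms rep_eq_iff[of s "{}"] A_closed(2) measurable[OF assms]
  by (simp add: null_sets_def emeasure_eq_measure)

lemma bool_algebra_quotient: "bool_algebra Q"
proof
  show "bmeet Q (bmeet Q a b) c = bmeet Q a (bmeet Q b c)"
    if "a \<in> elems Q" "b \<in> elems Q" "c \<in> elems Q" for a b c
    using that by (auto simp: rep_simps Int_assoc)
  show "bjoin Q (bjoin Q a b) c = bjoin Q a (bjoin Q b c)"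
    if "a \<in> elems Q" "b \<in> elems Q" "c \<in> elems Q" for a b c
    using that by (auto simp: rep_simps Un_assoc)
  show "bmeet Q a (bjoin Q b c) = bjoin Q (bmeet Q a b) (bmeet Q a c)"
    if "a \<in> elems Q" "b \<in> elems Q" "c \<in> elems Q" for a b c
    using that unfolding null_quotient_sel
    by (elim imageE) (simp add: rep_simps, simp add: Int_Un_distrib)
  show "bjoin Q a (bmeet Q b c) = bmeet Q (bjoin Q a b) (bjoin Q a c)"
    if "a \<in> elems Q" "b \<in> elems Q" "c \<in> elems Q" for a b c
    using that unfolding null_quotient_sel
    by (elim imageE) (simp add: rep_simps, simp add: Un_Int_distrib)
  show "bmeet Q a b = bmeet Q b a" "bjoin Q a b = bjoin Q b a" for a b
    by (simp_all add: Int_commute Un_commute)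
qed (auto simp: rep_simps)

section \<open>Measures on the quotient algebra\<close>

lemma supports_measure: "supports Q (measure M)"
  unfolding supports_def ba_measure_def
proof (intro conjI ballI impI)
  show "measure M (bunit Q) = 1"
    using prob_space by (simp add: measure_rep A_closed space_UNIV)
  show "measure M (bjoin Q a b) = measure M a + measure M b"
    if ab: "a \<in> elems Q" "b \<in> elems Q" "bmeet Q a b = bzero Q" for a b
  proof -
    obtain s t where st: "s \<in> A" "a = rep s" "t \<in> A" "b = rep t" using ab by auto
    \<comment> \<open>Disjointness in the quotient makes the intersection null, not empty.\<close>
    have "s \<inter> t \<in> null_sets M"
      using ab(3) st rep_eq_iff[of "s \<inter> t" "{}"] by (simp add: rep_simps)
    then have "measure M (s \<union> t) = measure M s + measure M t"
      using finite_measure_Union'[of s t] finite_measure_Diff'[of t s] st measurable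
      by (simp add: measure_eq_0_null_sets Int_commute)
    then show ?thesis using st by (simp add: rep_simps measure_rep)
  qed
  show "0 < measure M a" if a: "a \<in> elems Q" "a \<noteq> bzero Q" for a
  proof -
    obtain s where s: "s \<in> A" "a = rep s"
      using a(1) by auto
    then have "measure M s \<noteq> 0" using a(2) rep_eq_empty_iff[OF s(1)] by simp
    then show ?thesis using s by (simp add: measure_rep zero_less_measure_iff)
  qed
qed auto

lemma ba_measure_additive:
  assumes "ba_measure Q \<mu>" "s \<in> A" "t \<in> A" "s \<inter> t = {}"
  shows "\<mu> (rep (s \<union> t)) = \<mu> (rep s) + \<mu> (rep t)"
proof -
  have "bmeet Q (rep s) (rep t) = bzero Q" using assms by (simp add: rep_simps)
  then have "\<mu> (bjoin Q (rep s) (rep t)) = \<mu> (rep s) + \<mu> (rep t)"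
    using assms(1-3) unfolding ba_measure_def by auto
  then show ?thesis using assms(2,3) by (simp add: rep_simps)
qed

lemma bsymdiff_rep: "\<lbrakk>s \<in> A; t \<in> A\<rbrakk> \<Longrightarrow> bsymdiff Q (rep s) (rep t) = rep (sym_diff s t)"
  by (simp add: bsymdiff_def bdiff_def rep_simps Diff_eq)

text \<open>Regularity is applied with \<open>\<mu> (rep s)\<close> itself as the tolerance: the
  zero element would leave a difference of that full measure, so the \<open>d\<close> obtained is
  non-zero. The conclusion speaks of \<open>M\<close> alone because non-zero classes are those of
  positive \<open>M\<close>-measure.\<close>

lemma uniformly_regular_pi_base:
  assumes "supports Q \<mu>" "uniformly_regular Q \<mu>"
  obtains D where "countable D" "D \<subseteq> A"
    "\<And>s. \<lbrakk>s \<in> A; 0 < measure M s\<rbrakk> \<Longrightarrow> \<exists>d\<in>D. 0 < measure M d \<and> measure M (d - s) = 0"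
proof -
  obtain D where D: "countable D" "D \<subseteq> elems Q"
    "\<And>a e. \<lbrakk>a \<in> elems Q; 0 < e\<rbrakk> \<Longrightarrow> \<exists>d\<in>D. ble Q d a \<and> \<mu> (bdiff Q a d) < e"
    using assms(2) unfolding uniformly_regular_def by metis
  have Drep: "D \<subseteq> rep ` A" using D(2) by simp
  then have DA: "D \<subseteq> A" using rep(1) by blast
  have "\<exists>d\<in>D. 0 < measure M d \<and> measure M (d - s) = 0" if s: "s \<in> A" "0 < measure M s" for s
  proof -
    have sQ: "rep s \<in> elems Q" using s(1) by simp
    have "rep s \<noteq> bzero Q" using s by (simp add: rep_eq_empty_iff)
    then have pos: "0 < \<mu> (rep s)" using assms(1) sQ unfolding supports_def by blast
    then obtain d where d: "d \<in> D" "ble Q d (rep s)" "\<mu> (bdiff Q (rep s) d) < \<mu> (rep s)"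
      using D(3)[OF sQ pos] by blast
    have dA: "d \<in> A" using d(1) DA by blast
    have dd: "rep d = d" using d(1) Drep rep_rep by blast
    have "rep (d \<inter> s) = rep d" using d(2) dA s(1) dd by (simp add: ble_def rep_simps)
    then have "sym_diff (d \<inter> s) d \<in> null_sets M" using dA s(1) by (simp add: rep_eq_iff A_closed)
    moreover have "sym_diff (d \<inter> s) d = d - s" by blast
    ultimately have "measure M (d - s) = 0" by (simp add: measure_eq_0_null_sets)
    moreover have "measure M d \<noteq> 0"
    proof
      assume "measure M d = 0"
      then have "d = rep {}" using rep_eq_empty_iff[OF dA] dd by simp
      then have "bdiff Q (rep s) d = rep s" using s(1) by (simp add: bdiff_def rep_simps)
      then show False using d(3) by simp
    qed
    ultimately show ?thesis using d(1) by (auto simp: zero_less_measure_iff)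
  qed
  then show ?thesis by (rule that[OF D(1) DA])
qed

end

section \<open>The transfinite construction\<close>

text \<open>Well-founded recursion along the order. Countably many predecessors generate a countable
  algebra over \<open>B\<close>, so the one-step construction applies at every index.\<close>

lemma exists_traced_family:
  fixes M :: "'a::polish_space measure"
  assumes M: "prob_space M" "sets M = sets borel" and atom: "\<And>x. measure M {x} = 0"
    and B: "topological_basis B" "countable B" and ord: "omega1_order I P"
  shows "\<exists>a. \<forall>i. a i \<in> sets M \<and> 0 < measure M (a i)
    \<and> (\<forall>s\<in>set_algebra (B \<union> a ` P i). \<exists>c\<in>set_algebra B. a i \<inter> s = a i \<inter> c)
    \<and> (\<forall>s\<in>set_algebra (B \<union> a ` P i). 0 < measure M s \<longrightarrow> 0 < measure M (s - a i))"
proof -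
  interpret omega1_order I P by fact
  interpret prob_space M by fact
  have sp: "space M = UNIV" using sets_eq_imp_space_eq[OF M(2)] by simp
  \<comment> \<open>The condition sees earlier choices only through their set \<open>F\<close>, so
    restricting the recursive function to predecessors by \<open>cut\<close> loses nothing.\<close>
  define good where "good F x \<longleftrightarrow> x \<in> sets M \<and> 0 < measure M x
    \<and> (\<forall>s\<in>set_algebra (B \<union> F). \<exists>c\<in>set_algebra B. x \<inter> s = x \<inter> c)
    \<and> (\<forall>s\<in>set_algebra (B \<union> F). 0 < measure M s \<longrightarrow> 0 < measure M (s - x))" for F x
  define R where "R = {(j, i). j \<in> P i}"
  define a where "a = wfrec R (\<lambda>f i. SOME x. good (f ` P i) x)"
  have a: "a i = (SOME x. good (a ` P i) x)" for i
  proof -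
    have "a i = (SOME x. good (cut a R i ` P i) x)"
      unfolding a_def using wf_pred by (subst wfrec) (simp_all add: R_def)
    also have "cut a R i ` P i = a ` P i" by (auto simp: cut_def R_def)
    finally show ?thesis .
  qed
  have good: "good (a ` P i) (a i)" for i
    using wf_pred
  proof (induction i rule: wf_induct_rule)
    case (less i)
    then have "a ` P i \<subseteq> sets M" by (auto simp: good_def)
    moreover have "B \<subseteq> sets M" using topological_basis_open[OF B(1)] M(2) by auto
    ultimately have "B \<union> a ` P i \<subseteq> sets M" by blast
    then interpret measured_set_algebra M "B \<union> a ` P i"
      by unfold_locales (rule sp)
    have "countable A"
      using B(2) countable_pred by (intro countable_set_algebra) auto
    moreover have "A \<subseteq> sets M" using measurable by blast
    ultimately have "\<exists>x. good (a ` P i) x"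
      using exists_set_tracing_countable_family[OF M atom B, of A] unfolding good_def by blast
    then show ?case unfolding a[of i] by (rule someI_ex)
  qed
  show ?thesis
    using good unfolding good_def by (intro exI[of _ a] allI)
qed

theorem theorem6p3:
  "\<exists>\<AA> :: real set bool_alg.
     kelley_algebra \<AA> \<and>
     (\<forall>\<mu>. supports \<AA> \<mu> \<longrightarrow> separable_measure \<AA> \<mu>) \<and>
     (\<forall>\<mu>. supports \<AA> \<mu> \<longrightarrow> \<not> uniformly_regular \<AA> \<mu>)"
proof -
  \<comment> \<open>Lebesgue measure on the unit interval, carried by the whole line so that
    \<open>space M\<close> is \<open>UNIV\<close> and the lemmas on Polish spaces apply.\<close>
  define M where "M = uniform_measure lborel {0..1 :: real}"
  have M: "prob_space M" "sets M = sets borel"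
    unfolding M_def by (rule prob_space_uniform_measure) auto
  have atom: "measure M {x} = 0" for x
    by (simp add: M_def measure_def emeasure_lborel_countable)
  obtain B :: "real set set" where B: "topological_basis B" "countable B"
    using ex_countable_basis by blast
  obtain I :: "nat set set" and P where "omega1_order I P" by (rule exists_omega1_order)
  interpret omega1_order I P by fact
  obtain a where fam: "\<forall>i. a i \<in> sets M \<and> 0 < measure M (a i)
    \<and> (\<forall>s\<in>set_algebra (B \<union> a ` P i). \<exists>c\<in>set_algebra B. a i \<inter> s = a i \<inter> c)
    \<and> (\<forall>s\<in>set_algebra (B \<union> a ` P i). 0 < measure M s \<longrightarrow> 0 < measure M (s - a i))"
    using exists_traced_family[OF M atom B \<open>omega1_order I P\<close>] ..
  have a: "a i \<in> sets M" "0 < measure M (a i)" for i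
    using fam[rule_format, of i] by simp_all
  interpret traced_family I P B a
    by unfold_locales (use B(2) fam in simp_all)
  interpret prob_space M by fact
  interpret measured_set_algebra M "B \<union> a ` I"
    using topological_basis_open[OF B(1)] a(1) M(2) sets_eq_imp_space_eq[OF M(2)]
    by unfold_locales auto
  have alg_I: "alg I = set_algebra (B \<union> a ` I)" by (simp add: alg_def)
  have "separable_measure Q \<mu>" if \<mu>: "supports Q \<mu>" for \<mu>
  proof -
    have ba: "ba_measure Q \<mu>" using \<mu> by (simp add: supports_def)
    have "\<exists>D. countable D \<and> D \<subseteq> alg I \<and> (\<forall>s\<in>alg I. \<forall>e>0. \<exists>d\<in>D. \<mu> (rep (sym_diff s d)) < e)"
    proof (rule exists_countable_dense)
      show "0 \<le> \<mu> (rep s)" if "s \<in> alg I" for s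
        using ba that by (simp add: ba_measure_def alg_I)
      show "\<mu> (rep (s \<union> t)) = \<mu> (rep s) + \<mu> (rep t)"
        if "s \<in> alg I" "t \<in> alg I" "s \<inter> t = {}" for s t
        using ba_measure_additive[OF ba] that by (simp add: alg_I)
    qed
    then obtain D where D: "countable D" "D \<subseteq> A"
      "\<forall>s\<in>A. \<forall>e>0. \<exists>d\<in>D. \<mu> (rep (sym_diff s d)) < e"
      unfolding alg_I by blast
    have "\<exists>d\<in>rep ` D. \<mu> (bsymdiff Q b d) < e" if b: "b \<in> elems Q" and e: "0 < e" for b e
    proof -
      obtain s where s: "s \<in> A" "b = rep s" using b by auto
      obtain d where d: "d \<in> D" "\<mu> (rep (sym_diff s d)) < e" using D(3) s(1) e by blast
      have "\<mu> (bsymdiff Q b (rep d)) < e"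
        using d(2) bsymdiff_rep[OF s(1), of d] s(2) D(2) d(1) by auto
      then show ?thesis using d(1) by blast
    qed
    then show ?thesis
      unfolding separable_measure_def using D(1,2) by (intro exI[of _ "rep ` D"]) auto
  qed
  moreover have "\<not> uniformly_regular Q \<mu>" if \<mu>: "supports Q \<mu>" for \<mu>
  proof
    assume "uniformly_regular Q \<mu>"
    then obtain D where D: "countable D" "D \<subseteq> A"
      "\<And>s. \<lbrakk>s \<in> A; 0 < measure M s\<rbrakk> \<Longrightarrow> \<exists>d\<in>D. 0 < measure M d \<and> measure M (d - s) = 0"
      using uniformly_regular_pi_base[OF \<mu>] by metis
    have "\<exists>J. finite J \<and> J \<subseteq> I \<and> d \<in> alg J" if d: "d \<in> D" for d
    proof -
      have "d \<in> alg I" using D(2) d alg_I by blast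
      then show ?thesis by (rule alg_finite) blast
    qed
    then obtain J where J: "\<And>d. d \<in> D \<Longrightarrow> finite (J d)" "\<And>d. d \<in> D \<Longrightarrow> J d \<subseteq> I"
      "\<And>d. d \<in> D \<Longrightarrow> d \<in> alg (J d)" by metis
    \<comment> \<open>All of \<open>D\<close> is generated before some index \<open>i\<close>. Then
      \<open>a i\<close> is non-null but almost contains no non-null member of
      \<open>D\<close>.\<close>
    have "uncountable {i \<in> I. (\<Union>d\<in>D. J d) \<subseteq> P i}"
    proof (rule uncountable_above[OF uncountable_index])
      show "countable (\<Union>d\<in>D. J d)"
        by (rule countable_UN[OF D(1) countable_finite[OF J(1)]])
      show "(\<Union>d\<in>D. J d) \<subseteq> I" using J(2) by (rule UN_least)
    qed simp
    then have "{i \<in> I. (\<Union>d\<in>D. J d) \<subseteq> P i} \<noteq> {}" by (metis countable_empty)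
    then obtain i where i: "i \<in> I" "(\<Union>d\<in>D. J d) \<subseteq> P i" by blast
    have DP: "d \<in> alg (P i)" if "d \<in> D" for d
      using J(3)[OF that] alg_mono[of "J d" "P i"] i(2) that by blast
    have "a i \<in> A" using in_alg[OF i(1)] by (simp add: alg_I)
    then obtain d where d: "d \<in> D" "0 < measure M d" "measure M (d - a i) = 0"
      using D(3)[OF _ a(2)] by blast
    have "d \<in> set_algebra (B \<union> a ` P i)" using DP[OF d(1)] by (simp add: alg_def)
    then have "0 < measure M (d - a i)" using fam d(2) by blast
    then show False using d(3) by simp
  qed
  moreover have "kelley_algebra Q"
    unfolding kelley_algebra_def using bool_algebra_quotient supports_measure by blast
  ultimately show ?thesis by blast
qed

end
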